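(* Let $p,\alpha,\beta>0$, $\delta\in(0,1)$ and $A>1$. Let $1\leq k\leq n$ be integers and let $0<x_1\leq\dots\leq x_n$ be real numbers. Let $\xi_1,\dots,\xi_n$ and $\eta_1,\dots,\eta_n$ be random variables each of which satisfies the $(\alpha,\beta)$-condition and the cdf-decay condition with parameters $\delta$ and $A$. Assume in addition that $\xi_1,\dots,\xi_n$ are jointly independent (no assumption is made on the dependence between the $\eta_i$'s). Then $$\mathbb{E}\sum_{j=1}^{k} j\text{-}\min_{1\leq i\leq n}|x_i\xi_i|^p\;\leq\; 6\left(\frac{32A\alpha}{\delta\beta}\right)^p\Gamma(1+p)\;\mathbb{E}\sum_{j=1}^{k} j\text{-}\min_{1\leq i\leq n}|x_i\eta_i|^p .$$ In particular, there is an absolute constant $C>0$ (independent of $p,k,n$ and the $x_i$) such that if all $\xi_i,\eta_i$ are standard Gaussian variables (with $\xi_1,\dots,\xi_n$ jointly independent), then $$\mathbb{E}\sum_{j=1}^{k} j\text{-}\min_{1\leq i\leq n}|x_i\xi_i|^p\;\leq\; 6\,(Cp)^p\;\mathbb{E}\sum_{j=1}^{k} j\text{-}\min_{1\leq i\leq n}|x_i\eta_i|^p .$$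
   Context: For a real sequence $a_1,\dots,a_n$ and $1\leq j\leq n$, $j\text{-}\min_{1\leq i\leq n}a_i$ denotes its $j$-th smallest element (counted with multiplicity). A random variable $\xi$ satisfies the $(\alpha,\beta)$-condition if $\mathbb{P}(|\xi|\leq t)\leq \alpha t$ for every $t\geq 0$ and $\mathbb{P}(|\xi|>t)\leq e^{-\beta t}$ for every $t\geq 0$. A random variable $\xi$ satisfies the cdf-decay condition with parameters $\delta\in(0,1)$ and $A>1$ if the cumulative distribution function $F(t)=\mathbb{P}(|\xi|\leq t)$ of $|\xi|$ satisfies $F(t)\geq 2F(t/A)$ whenever $F(t)\leq\delta$. $\Gamma$ is the Gamma function. *)

theory Defs
  imports "HOL-Probability.Probability"
begin

text \<open>The \<open>j\<close>-th smallest of \<open>a 1, \<dots>, a n\<close>, counted with multiplicity. Meaningful for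
  \<open>1 \<le> j \<le> n\<close> only.\<close>

definition jmin :: "nat \<Rightarrow> nat \<Rightarrow> (nat \<Rightarrow> real) \<Rightarrow> real" where
  "jmin j n a = sort (map a [1..<Suc n]) ! (j - 1)"

definition alpha_beta_condition :: "'a measure \<Rightarrow> real \<Rightarrow> real \<Rightarrow> ('a \<Rightarrow> real) \<Rightarrow> bool" where
  "alpha_beta_condition M \<alpha> \<beta> X \<longleftrightarrow>
     (\<forall>t\<ge>0. measure M {\<omega> \<in> space M. \<bar>X \<omega>\<bar> \<le> t} \<le> \<alpha> * t) \<and>
     (\<forall>t\<ge>0. measure M {\<omega> \<in> space M. \<bar>X \<omega>\<bar> > t} \<le> exp (- \<beta> * t))"

definition abs_cdf :: "'a measure \<Rightarrow> ('a \<Rightarrow> real) \<Rightarrow> real \<Rightarrow> real" where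
  "abs_cdf M X t = measure M {\<omega> \<in> space M. \<bar>X \<omega>\<bar> \<le> t}"

definition cdf_decay_condition :: "'a measure \<Rightarrow> real \<Rightarrow> real \<Rightarrow> ('a \<Rightarrow> real) \<Rightarrow> bool" where
  "cdf_decay_condition M \<delta> A X \<longleftrightarrow>
     (\<forall>t. abs_cdf M X t \<le> \<delta> \<longrightarrow> abs_cdf M X t \<ge> 2 * abs_cdf M X (t / A))"

definition expected_min_sum ::
    "'a measure \<Rightarrow> real \<Rightarrow> nat \<Rightarrow> nat \<Rightarrow> (nat \<Rightarrow> real) \<Rightarrow> (nat \<Rightarrow> 'a \<Rightarrow> real) \<Rightarrow> real" where
  "expected_min_sum M p k n x \<xi> =
     prob_space.expectation M (\<lambda>\<omega>. \<Sum>j=1..k. jmin j n (\<lambda>i. \<bar>x i * \<xi> i \<omega>\<bar> powr p))"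

text \<open>\<open>C\<close> is admissible in the Gaussian comparison for all families on the sample space \<open>M\<close>.
  This is a predicate, rather than being written out under a quantifier over \<open>C\<close>, because an
  absolute constant must not depend on the type of the sample space either, whereas in
  \<open>\<exists>C. \<forall>M :: 'a measure. \<dots>\<close> it may depend on \<open>'a\<close>. Uniformity over types is expressed by saying
  in addition that a constant admissible for all probability spaces on the fixed type
  \<open>nat \<Rightarrow> real\<close> is admissible for all probability spaces on any type.\<close>

definition gaussian_comparison :: "'a measure \<Rightarrow> real \<Rightarrow> bool" where
  "gaussian_comparison M C \<longleftrightarrow>
     (\<forall>(p::real) (k::nat) (n::nat) (x :: nat \<Rightarrow> real)
        (\<xi> :: nat \<Rightarrow> 'a \<Rightarrow> real) (\<eta> :: nat \<Rightarrow> 'a \<Rightarrow> real).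
        0 < p \<and> 1 \<le> k \<and> k \<le> n \<and> 0 < x 1 \<and> mono_on {1..n} x \<and>
        (\<forall>i\<in>{1..n}. distributed M lborel (\<xi> i) std_normal_density) \<and>
        (\<forall>i\<in>{1..n}. distributed M lborel (\<eta> i) std_normal_density) \<and>
        prob_space.indep_vars M (\<lambda>_. borel) \<xi> {1..n}
        \<longrightarrow> expected_min_sum M p k n x \<xi> \<le> 6 * (C * p) powr p * expected_min_sum M p k n x \<eta>)"

end

theory Submission
  imports Defs
begin

text \<open>Write \<open>S\<^sub>m\<close> for the sum of \<open>1 / x i\<close> over \<open>m < i \<le> n\<close>.

  For the variables \<open>\<eta> i\<close>, Markov's inequality applied to the number of indices \<open>i > m\<close> with
  \<open>\<bar>x i * \<eta> i\<bar> \<le> t\<close>, whose expectation is at most \<open>\<alpha> t S\<^sub>m\<close>, shows that with probability at least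
  \<open>1 / 2\<close> the \<open>j\<close>-th minimum of the \<open>\<bar>x i * \<eta> i\<bar>\<close> exceeds \<open>(j - m) / (2 \<alpha> S\<^sub>m)\<close>.

  For the variables \<open>\<xi> i\<close>, the sum of the \<open>k\<close> smallest values is at most the sum of the minima over
  \<open>k\<close> disjoint blocks of indices, and by independence the minimum over a block \<open>B\<close> is dominated by an
  exponential variable with rate \<open>\<beta>\<close> times the sum of \<open>1 / x i\<close> over \<open>B\<close>.

  Take the least \<open>m < k\<close> with \<open>(k - m) / x (m + 1) \<le> S\<^sub>m\<close>, let each of the first \<open>m\<close> indices be a
  block, and split the others into \<open>k - m\<close> blocks of nearly equal weight. The two bounds then
  match, with the constant \<open>4 (8 \<alpha> / \<beta>)\<^sup>p \<Gamma>(1 + p)\<close>. A standard normal variable satisfies the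
  \<open>(\<alpha>, \<beta>)\<close>-condition with \<open>\<alpha> = \<beta> = sqrt (2 / pi)\<close>, which gives \<open>C = 24\<close>.

  A constant is transferred to an arbitrary sample space by replacing the probability measure with
  the joint law of the \<open>\<xi> i\<close> and \<open>\<eta> i\<close>, a measure on \<open>nat \<Rightarrow> real\<close>.\<close>

section \<open>The \<open>j\<close>-th minimum through counting\<close>

text \<open>In a sorted list the entries at most \<open>t\<close> fill an initial segment, and
  position \<open>j - 1\<close> (counted from 0) lies in it exactly when the segment has length at
  least \<open>j\<close>.\<close>

lemma sorted_nth_le_iff:
  fixes s :: "'b::linorder list"
  assumes "sorted s" "1 \<le> j" "j \<le> length s"
  shows "s ! (j - 1) \<le> t \<longleftrightarrow> j \<le> length (filter (\<lambda>y. y \<le> t) s)"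
proof
  assume le: "s ! (j - 1) \<le> t"
  have "s ! i \<le> t" if "i < j" for i
    using sorted_nth_mono[OF assms(1), of i "j - 1"] that assms le by force
  then have "{..<j} \<subseteq> {i. i < length s \<and> s ! i \<le> t}"
    using assms by auto
  from card_mono[OF _ this] show "j \<le> length (filter (\<lambda>y. y \<le> t) s)"
    by (simp add: length_filter_conv_card)
next
  assume card: "j \<le> length (filter (\<lambda>y. y \<le> t) s)"
  show "s ! (j - 1) \<le> t"
  proof (rule ccontr)
    assume gt: "\<not> s ! (j - 1) \<le> t"
    have "i < j - 1" if "i < length s" "s ! i \<le> t" for i
      using sorted_nth_mono[OF assms(1), of "j - 1" i] that gt
      by (meson not_le_imp_less order_trans)
    then have "{i. i < length s \<and> s ! i \<le> t} \<subseteq> {..<j - 1}"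
      by auto
    from card_mono[OF _ this] card assms(2) show False
      by (simp add: length_filter_conv_card)
  qed
qed

text \<open>Sorting only permutes the list, so small entries can be counted over the indices. Most
  later facts about \<open>jmin\<close> rest on this count.\<close>

lemma jmin_le_iff:
  assumes "1 \<le> j" "j \<le> n"
  shows "jmin j n a \<le> t \<longleftrightarrow> j \<le> card {i \<in> {1..n}. a i \<le> t}"
proof -
  have "mset (filter (\<lambda>y. y \<le> t) (sort (map a [1..<Suc n]))) =
      mset (filter (\<lambda>y. y \<le> t) (map a [1..<Suc n]))"
    by (simp only: mset_filter mset_sort)
  then have "length (filter (\<lambda>y. y \<le> t) (sort (map a [1..<Suc n]))) =
      length (filter (\<lambda>y. y \<le> t) (map a [1..<Suc n]))"
    by (metis size_mset)
  also have "\<dots> = length (filter (\<lambda>i. a i \<le> t) [1..<Suc n])"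
    by (simp only: filter_map length_map o_def)
  also have "\<dots> = card (set (filter (\<lambda>i. a i \<le> t) [1..<Suc n]))"
    by (intro distinct_card[symmetric]) simp
  also have "set (filter (\<lambda>i. a i \<le> t) [1..<Suc n]) = {i \<in> {1..n}. a i \<le> t}"
    by auto
  finally show ?thesis
    unfolding jmin_def using assms by (subst sorted_nth_le_iff) (auto simp del: upt_Suc)
qed

lemma jmin_nonneg:
  assumes "1 \<le> j" "j \<le> n" and "\<And>i. i \<in> {1..n} \<Longrightarrow> 0 \<le> a i"
  shows "0 \<le> jmin j n a"
proof -
  have "1 \<le> card {i \<in> {1..n}. a i \<le> jmin j n a}"
    using jmin_le_iff[OF assms(1,2), of a "jmin j n a"] assms(1) by simp
  then have "{i \<in> {1..n}. a i \<le> jmin j n a} \<noteq> {}"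
    by (metis card.empty not_one_le_zero)
  then obtain i where "i \<in> {1..n}" "a i \<le> jmin j n a"
    by auto
  with assms(3)[of i] show ?thesis by simp
qed

text \<open>Induction on \<open>k\<close>, removing from \<open>I\<close> an index \<open>e\<close>
  with the largest value: at least \<open>Suc k\<close> values are at most \<open>a e\<close>, so
  \<open>a e\<close> pays for the minimum of rank \<open>Suc k\<close> and the other indices pay for
  the rest.\<close>

lemma sum_jmin_le_sum:
  assumes "I \<subseteq> {1..n}" "card I = k"
  shows "(\<Sum>j=1..k. jmin j n a) \<le> sum a I"
  using assms
proof (induction k arbitrary: I)
  case 0
  then have "I = {}" using finite_subset[OF 0(1)] by simp
  then show ?case by simp
next
  case (Suc k)
  have fin: "finite I" using Suc.prems(1) finite_subset by blast
  have "Max (a ` I) \<in> a ` I"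
    using fin Suc.prems(2) by (intro Max_in) auto
  then obtain e where e: "e \<in> I" "a e = Max (a ` I)" by auto
  have "I \<subseteq> {i \<in> {1..n}. a i \<le> a e}"
    using Suc.prems(1) fin e by auto
  then have "Suc k \<le> card {i \<in> {1..n}. a i \<le> a e}"
    using card_mono[of "{i \<in> {1..n}. a i \<le> a e}" I] Suc.prems(2) by simp
  moreover have "Suc k \<le> n"
    using card_mono[of "{1..n}" I] Suc.prems by simp
  ultimately have "jmin (Suc k) n a \<le> a e"
    using jmin_le_iff[of "Suc k" n a "a e"] by simp
  moreover have "(\<Sum>j=1..k. jmin j n a) \<le> sum a (I - {e})"
    using Suc.prems e fin by (intro Suc.IH) auto
  ultimately show ?case
    using e fin by (simp add: sum.remove)
qed

text \<open>One minimizer from each block gives \<open>k\<close> indices, distinct because the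
  blocks are disjoint.\<close>

lemma sum_jmin_le_sum_Min:
  fixes a :: "nat \<Rightarrow> real"
  assumes "\<And>i. i \<in> {1..k} \<Longrightarrow> B i \<subseteq> {1..n}" "\<And>i. i \<in> {1..k} \<Longrightarrow> B i \<noteq> {}"
    and "disjoint_family_on B {1..k}"
  shows "(\<Sum>j=1..k. jmin j n a) \<le> (\<Sum>i=1..k. Min (a ` B i))"
proof -
  have "\<exists>e. e \<in> B i \<and> a e = Min (a ` B i)" if "i \<in> {1..k}" for i
  proof -
    have "finite (B i)" using assms(1)[OF that] finite_subset by blast
    then have "Min (a ` B i) \<in> a ` B i"
      using assms(2)[OF that] by (intro Min_in) auto
    then show ?thesis by auto
  qed
  then obtain f where f: "\<And>i. i \<in> {1..k} \<Longrightarrow> f i \<in> B i \<and> a (f i) = Min (a ` B i)"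
    by metis
  have inj: "inj_on f {1..k}"
    using f assms(3) unfolding disjoint_family_on_def inj_on_def by (metis disjoint_iff)
  have "(\<Sum>j=1..k. jmin j n a) \<le> sum a (f ` {1..k})"
  proof (rule sum_jmin_le_sum)
    show "f ` {1..k} \<subseteq> {1..n}" using f assms(1) by blast
    show "card (f ` {1..k}) = k" using card_image[OF inj] by simp
  qed
  also have "\<dots> = (\<Sum>i=1..k. Min (a ` B i))"
    using f by (subst sum.reindex[OF inj]) (auto intro: sum.cong)
  finally show ?thesis .
qed

lemma borel_measurable_jmin [measurable]:
  assumes "1 \<le> j" "j \<le> n" and [measurable]: "\<And>i. i \<in> {1..n} \<Longrightarrow> X i \<in> borel_measurable M"
  shows "(\<lambda>\<omega>. jmin j n (\<lambda>i. X i \<omega>)) \<in> borel_measurable M"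
proof -
  have "real (card {i \<in> {1..n}. X i \<omega> \<le> t}) = (\<Sum>i=1..n. if X i \<omega> \<le> t then 1 else 0)" for \<omega> t
    by (simp add: sum.If_cases Int_def)
  then have "jmin j n (\<lambda>i. X i \<omega>) \<le> t \<longleftrightarrow> real j \<le> (\<Sum>i=1..n. if X i \<omega> \<le> t then 1 else 0)" for \<omega> t
    using jmin_le_iff[OF assms(1,2)] by (metis of_nat_le_iff)
  then show ?thesis
    by (subst borel_measurable_iff_le) (simp, measurable)
qed

section \<open>Combinatorics of blocks and ranks\<close>

text \<open>Greedy choice: a set of weight at least \<open>c / 2\<close> with the fewest elements
  weighs at most \<open>c\<close>, so its removal leaves enough weight for the remaining
  blocks.\<close>

lemma exists_disjoint_blocks:
  fixes w :: "'b \<Rightarrow> real"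
  assumes "finite I" "\<And>i. i \<in> I \<Longrightarrow> w i \<le> c" "0 < c" "real K * c \<le> sum w I"
  shows "\<exists>B. (\<forall>l<K. B l \<subseteq> I \<and> c / 2 \<le> sum w (B l)) \<and> disjoint_family_on B {..<K}"
  using assms
proof (induction K arbitrary: I)
  case 0
  show ?case by (simp add: disjoint_family_on_def)
next
  case (Suc K)
  let ?P = "\<lambda>J. J \<subseteq> I \<and> c / 2 \<le> sum w J"
  have "1 * c \<le> real (Suc K) * c"
    using \<open>0 < c\<close> by (intro mult_right_mono) auto
  then have "c / 2 \<le> sum w I"
    using Suc.prems(3,4) by linarith
  then have "?P I" by simp
  define J where "J = arg_min card ?P"
  have J: "?P J" and min: "card J \<le> card J'" if "?P J'" for J'
    unfolding J_def using arg_min_natI[of ?P I card] arg_min_nat_le[of ?P J' card] \<open>?P I\<close> that by auto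
  then have J: "?P J" using \<open>?P I\<close> by blast
  have finJ: "finite J" using J Suc.prems(1) finite_subset by blast
  have "J \<noteq> {}" using J \<open>0 < c\<close> by auto
  then obtain e where e: "e \<in> J" by auto
  have le: "sum w J \<le> c"
  proof (cases "c / 2 \<le> w e")
    \<comment> \<open>If \<open>e\<close> alone weighs at least \<open>c / 2\<close>, minimality
      forces \<open>J = {e}\<close> and the bound on single weights applies. Otherwise
      \<open>e\<close> weighs less than \<open>c / 2\<close>, and by minimality so does
      \<open>J - {e}\<close>.\<close>
    case True
    with J e have "card J \<le> card {e}"
      by (intro min) auto
    with e finJ have "J = {e}"
      by (metis card_1_singletonE card_0_eq One_nat_def card.empty card.insert empty_iff finite.emptyI
          insert_absorb le_Suc_eq le_zero_eq singletonD)
    with e J Suc.prems(2) show ?thesis by auto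
  next
    case False
    have "\<not> ?P (J - {e})"
    proof
      assume "?P (J - {e})"
      from min[OF this] card_Diff1_less[OF finJ e] show False by simp
    qed
    then have "sum w (J - {e}) < c / 2" using J by auto
    with False show ?thesis using sum.remove[OF finJ e, of w] by simp
  qed
  have "real K * c \<le> sum w (I - J)"
    using le Suc.prems J by (simp add: sum_diff algebra_simps)
  with Suc.IH[of "I - J"] Suc.prems obtain B where
    B: "\<forall>l<K. B l \<subseteq> I - J \<and> c / 2 \<le> sum w (B l)" and dis: "disjoint_family_on B {..<K}"
    by auto
  have "disjoint_family_on (B(K := J)) {..<Suc K}"
    using dis B unfolding disjoint_family_on_def by (auto simp: less_Suc_eq) blast+
  moreover have "\<forall>l<Suc K. (B(K := J)) l \<subseteq> I \<and> c / 2 \<le> sum w ((B(K := J)) l)"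
    using B J by (auto simp: less_Suc_eq)
  ultimately show ?case by blast
qed

text \<open>The map from \<open>i\<close> to \<open>(k + i + 1) div 2\<close> sends
  \<open>{1..k}\<close> into its upper half and takes each value at most twice.\<close>

lemma sum_upper_half_le:
  fixes g :: "nat \<Rightarrow> real"
  assumes "\<And>j. j \<in> {1..k} \<Longrightarrow> 0 \<le> g j"
  shows "(\<Sum>i=1..k. g ((k + i + 1) div 2)) \<le> 2 * (\<Sum>j=1..k. g j)"
proof -
  have "(\<Sum>i=1..k. g ((k + i + 1) div 2)) =
      (\<Sum>j=1..k. \<Sum>i | i \<in> {1..k} \<and> (k + i + 1) div 2 = j. g ((k + i + 1) div 2))"
    by (intro sum.group[symmetric]) auto
  also have "\<dots> = (\<Sum>j=1..k. real (card {i \<in> {1..k}. (k + i + 1) div 2 = j}) * g j)"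
    by (intro sum.cong) auto
  also have "\<dots> \<le> (\<Sum>j=1..k. 2 * g j)"
  proof (intro sum_mono mult_right_mono)
    fix j assume "j \<in> {1..k}"
    have "card {i \<in> {1..k}. (k + i + 1) div 2 = j} \<le> card {2 * j - k - 1, 2 * j - k}"
      by (intro card_mono) auto
    also have "\<dots> \<le> 2" by (simp add: card_insert_if)
    finally show "real (card {i \<in> {1..k}. (k + i + 1) div 2 = j}) \<le> 2" by simp
  qed (use assms in auto)
  finally show ?thesis by (simp add: sum_distrib_left)
qed

section \<open>Tail integrals and moment bounds\<close>

text \<open>Layer-cake formula: \<open>f x\<close> is the length of \<open>{0..<f x}\<close>, and
  the two integrations are exchanged.\<close>

lemma nn_integral_eq_nn_integral_tail:
  fixes f :: "'a \<Rightarrow> real"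
  assumes "sigma_finite_measure M" and [measurable]: "f \<in> borel_measurable M"
  shows "(\<integral>\<^sup>+ x. ennreal (f x) \<partial>M) =
    (\<integral>\<^sup>+ s. emeasure M {x \<in> space M. s < f x} * indicator {0..} s \<partial>lborel)"
proof -
  interpret sigma_finite_measure M by fact
  interpret pair_sigma_finite M "lborel :: real measure" ..
  let ?g = "\<lambda>x s. if 0 \<le> s \<and> s < f x then 1 else 0 :: ennreal"
  have "ennreal (f x) = (\<integral>\<^sup>+ s. ?g x s \<partial>lborel)" for x
  proof -
    have "(\<integral>\<^sup>+ s. ?g x s \<partial>lborel) = (\<integral>\<^sup>+ s. indicator {0..<f x} s \<partial>lborel)"
      by (intro nn_integral_cong) (auto simp: indicator_def)
    also have "\<dots> = ennreal (f x)"
      \<comment> \<open>For negative \<open>f x\<close> the interval is empty and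
        \<open>ennreal\<close> truncates to 0.\<close>
      by (cases "0 \<le> f x") (auto simp: ennreal_neg)
    finally show ?thesis by simp
  qed
  then have "(\<integral>\<^sup>+ x. ennreal (f x) \<partial>M) = (\<integral>\<^sup>+ x. \<integral>\<^sup>+ s. ?g x s \<partial>lborel \<partial>M)"
    by simp
  also have "\<dots> = (\<integral>\<^sup>+ s. \<integral>\<^sup>+ x. ?g x s \<partial>M \<partial>lborel)"
    by (rule Fubini'[symmetric]) measurable
  also have "\<dots> = (\<integral>\<^sup>+ s. emeasure M {x \<in> space M. s < f x} * indicator {0..} s \<partial>lborel)"
  proof (intro nn_integral_cong)
    fix s :: real
    have "(\<integral>\<^sup>+ x. ?g x s \<partial>M) = (\<integral>\<^sup>+ x. indicator {0..} s * indicator {x \<in> space M. s < f x} x \<partial>M)"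
      by (intro nn_integral_cong) (auto simp: indicator_def)
    also have "\<dots> = indicator {0..} s * emeasure M {x \<in> space M. s < f x}"
      by (subst nn_integral_cmult_indicator) auto
    finally show "(\<integral>\<^sup>+ x. ?g x s \<partial>M) = emeasure M {x \<in> space M. s < f x} * indicator {0..} s"
      by (simp add: mult.commute)
  qed
  finally show ?thesis .
qed

lemma emeasure_exponential_greaterThan:
  assumes "0 < c" "0 \<le> t"
  shows "emeasure (density lborel (exponential_density c)) {t<..} = ennreal (exp (- c * t))"
proof -
  let ?E = "density lborel (exponential_density c)"
  interpret E: prob_space ?E
    using assms(1) by (rule prob_space_exponential_density)
  have "distributed ?E lborel (\<lambda>u. u) (exponential_density c)"
    unfolding distributed_def by (auto intro!: measure_eqI simp: emeasure_distr)
  from E.exponential_distributedD_gt[OF this assms(2,1)]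
  show ?thesis
    by (simp add: E.emeasure_eq_measure greaterThan_def mult.commute)
qed

text \<open>Stochastic domination by an exponential variable, whose \<open>p\<close>-th moment is a Gamma integral.\<close>

lemma (in prob_space) nn_integral_le_Gamma:
  fixes Y :: "'a \<Rightarrow> real"
  assumes [measurable]: "Y \<in> borel_measurable M" and "0 < p"
    and tail: "\<And>t. 0 \<le> t \<Longrightarrow> prob {\<omega> \<in> space M. t powr p < Y \<omega>} \<le> exp (- t)"
  shows "(\<integral>\<^sup>+ \<omega>. ennreal (Y \<omega>) \<partial>M) \<le> ennreal (Gamma (1 + p))"
proof -
  let ?E = "density lborel (exponential_density 1)"
  interpret E: prob_space ?E
    by (rule prob_space_exponential_density) simp
  have "(\<integral>\<^sup>+ \<omega>. ennreal (Y \<omega>) \<partial>M) =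
      (\<integral>\<^sup>+ s. emeasure M {\<omega> \<in> space M. s < Y \<omega>} * indicator {0..} s \<partial>lborel)"
    by (rule nn_integral_eq_nn_integral_tail) (unfold_locales, measurable)
  also have "\<dots> \<le> (\<integral>\<^sup>+ s. emeasure ?E {u \<in> space ?E. s < u powr p} * indicator {0..} s \<partial>lborel)"
  proof (intro nn_integral_mono)
    fix s :: real
    show "emeasure M {\<omega> \<in> space M. s < Y \<omega>} * indicator {0..} s
      \<le> emeasure ?E {u \<in> space ?E. s < u powr p} * indicator {0..} s"
    proof (cases "0 \<le> s")
      case True
      define t where "t = s powr (1 / p)"
      have t: "0 \<le> t" "t powr p = s"
        using True \<open>0 < p\<close> by (auto simp: t_def powr_powr)
      have "emeasure M {\<omega> \<in> space M. s < Y \<omega>} \<le> ennreal (exp (- 1 * t))"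
        using tail[OF t(1)] t(2) by (simp add: emeasure_eq_measure)
      also have "\<dots> = emeasure ?E {t<..}"
        using t by (subst emeasure_exponential_greaterThan) auto
      also have "\<dots> \<le> emeasure ?E {u \<in> space ?E. s < u powr p}"
      proof (rule emeasure_mono)
        show "{t<..} \<subseteq> {u \<in> space ?E. s < u powr p}"
          using t \<open>0 < p\<close> by (auto intro: powr_less_mono2)
      qed measurable
      finally show ?thesis by (intro mult_right_mono) auto
    qed simp
  qed
  also have "\<dots> = (\<integral>\<^sup>+ u. ennreal (u powr p) \<partial>?E)"
    by (rule nn_integral_eq_nn_integral_tail[symmetric]) (unfold_locales, measurable)
  also have "\<dots> = (\<integral>\<^sup>+ u. ennreal (exponential_density 1 u) * ennreal (u powr p) \<partial>lborel)"
    by (rule nn_integral_density) auto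
  also have "\<dots> = (\<integral>\<^sup>+ u. ennreal (indicator {0..} u * u powr (1 + p - 1) / exp u) \<partial>lborel)"
    by (intro nn_integral_cong)
       (auto simp: exponential_density_def ennreal_mult[symmetric] exp_minus field_simps indicator_def)
  also have "\<dots> = ennreal (Gamma (1 + p))"
    using Gamma_conv_nn_integral_real[of "1 + p"] \<open>0 < p\<close> by simp
  finally show ?thesis .
qed

text \<open>Multiplying \<open>Y\<close> by \<open>c powr p\<close> turns a tail of rate
  \<open>c\<close> into one of rate 1, because level \<open>t\<close> for the product is level
  \<open>t / c\<close> for \<open>Y\<close>.\<close>

lemma (in prob_space) moment_le_Gamma:
  fixes Y :: "'a \<Rightarrow> real"
  assumes [measurable]: "Y \<in> borel_measurable M" and "0 < p" "0 < c"
    and nonneg: "\<And>\<omega>. \<omega> \<in> space M \<Longrightarrow> 0 \<le> Y \<omega>"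
    and tail: "\<And>t. 0 \<le> t \<Longrightarrow> prob {\<omega> \<in> space M. t powr p < Y \<omega>} \<le> exp (- c * t)"
  shows "integrable M Y" "expectation Y \<le> Gamma (1 + p) * (1 / c) powr p"
proof -
  let ?Z = "\<lambda>\<omega>. c powr p * Y \<omega>"
  have le: "(\<integral>\<^sup>+ \<omega>. ennreal (?Z \<omega>) \<partial>M) \<le> ennreal (Gamma (1 + p))"
  proof (rule nn_integral_le_Gamma)
    fix t :: real assume "0 \<le> t"
    have "(t powr p < ?Z \<omega>) \<longleftrightarrow> (t / c) powr p < Y \<omega>" for \<omega>
      using \<open>0 < c\<close> \<open>0 \<le> t\<close> by (simp add: powr_divide field_simps)
    then show "prob {\<omega> \<in> space M. t powr p < ?Z \<omega>} \<le> exp (- t)"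
      using tail[of "t / c"] \<open>0 < c\<close> \<open>0 \<le> t\<close> by simp
  qed (use assms in auto)
  have int: "integrable M ?Z"
  proof (rule integrableI_nonneg)
    show "(\<integral>\<^sup>+ \<omega>. ennreal (?Z \<omega>) \<partial>M) < \<infinity>"
      using le by (rule order_le_less_trans) simp
  qed (use nonneg in auto)
  then show "integrable M Y"
    using \<open>0 < c\<close> by simp
  have "ennreal (expectation ?Z) \<le> ennreal (Gamma (1 + p))"
    using le int nonneg by (subst nn_integral_eq_integral[symmetric]) auto
  then have "expectation ?Z \<le> Gamma (1 + p)"
    using \<open>0 < p\<close> by (subst (asm) ennreal_le_iff) (auto intro!: Gamma_real_nonneg)
  then show "expectation Y \<le> Gamma (1 + p) * (1 / c) powr p"
    using \<open>0 < c\<close> by (simp add: powr_divide field_simps)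
qed

lemma scaled_powr_less_iff:
  fixes t x y p :: real
  assumes "0 \<le> t" "0 < x" "0 < p"
  shows "t powr p < \<bar>x * y\<bar> powr p \<longleftrightarrow> t / x < \<bar>y\<bar>"
proof -
  have "t powr p < \<bar>x * y\<bar> powr p \<longleftrightarrow> t < \<bar>x * y\<bar>"
    using assms by (meson abs_ge_zero linorder_not_less powr_less_mono2 powr_mono2 less_imp_le)
  also have "\<dots> \<longleftrightarrow> t / x < \<bar>y\<bar>"
    using assms by (simp add: abs_mult field_simps)
  finally show ?thesis .
qed

lemma (in prob_space) integrable_scaled_powr:
  assumes [measurable]: "X \<in> borel_measurable M" and "0 < p" "0 < \<beta>" "0 < x"
    and tail: "\<And>t. 0 \<le> t \<Longrightarrow> prob {\<omega> \<in> space M. \<bar>X \<omega>\<bar> > t} \<le> exp (- \<beta> * t)"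
  shows "integrable M (\<lambda>\<omega>. \<bar>x * X \<omega>\<bar> powr p)"
proof (rule moment_le_Gamma(1))
  show "prob {\<omega> \<in> space M. t powr p < \<bar>x * X \<omega>\<bar> powr p} \<le> exp (- (\<beta> / x) * t)" if "0 \<le> t" for t
    using tail[of "t / x"] that assms(2,4) by (simp add: scaled_powr_less_iff)
qed (use assms in auto)

text \<open>The minimum exceeds a level exactly when every member of the block does; by independence
  the tails multiply, so the rates \<open>\<beta> / x i\<close> add up.\<close>

lemma (in prob_space) Min_moment_le:
  assumes indep: "indep_vars (\<lambda>_. borel) X I" and B: "B \<subseteq> I" "finite B" "B \<noteq> {}"
    and "0 < p" "0 < \<beta>" and x: "\<And>i. i \<in> B \<Longrightarrow> 0 < x i"
    and tail: "\<And>i t. i \<in> B \<Longrightarrow> 0 \<le> t \<Longrightarrow> prob {\<omega> \<in> space M. \<bar>X i \<omega>\<bar> > t} \<le> exp (- \<beta> * t)"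
  shows "integrable M (\<lambda>\<omega>. Min ((\<lambda>i. \<bar>x i * X i \<omega>\<bar> powr p) ` B))"
    and "expectation (\<lambda>\<omega>. Min ((\<lambda>i. \<bar>x i * X i \<omega>\<bar> powr p) ` B))
      \<le> Gamma (1 + p) * (1 / (\<beta> * (\<Sum>i\<in>B. 1 / x i))) powr p"
proof -
  let ?Y = "\<lambda>\<omega>. Min ((\<lambda>i. \<bar>x i * X i \<omega>\<bar> powr p) ` B)"
  have meas [measurable]: "X i \<in> borel_measurable M" if "i \<in> B" for i
    using indep B that by (auto simp: indep_vars_def)
  have Y: "?Y \<in> borel_measurable M"
    using B by (intro borel_measurable_Min) measurable
  have pos: "0 < \<beta> * (\<Sum>i\<in>B. 1 / x i)"
    using B x \<open>0 < \<beta>\<close> by (intro mult_pos_pos sum_pos) auto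
  have nonneg: "0 \<le> ?Y \<omega>" for \<omega>
    using B by simp
  have "prob {\<omega> \<in> space M. t powr p < ?Y \<omega>} \<le> exp (- (\<beta> * (\<Sum>i\<in>B. 1 / x i)) * t)"
    if "0 \<le> t" for t
  proof -
    have "{\<omega> \<in> space M. t powr p < ?Y \<omega>} = (\<Inter>i\<in>B. X i -` {y. t / x i < \<bar>y\<bar>} \<inter> space M)"
      using B x that \<open>0 < p\<close> by (auto simp: scaled_powr_less_iff)
    then have "prob {\<omega> \<in> space M. t powr p < ?Y \<omega>} = (\<Prod>i\<in>B. prob (X i -` {y. t / x i < \<bar>y\<bar>} \<inter> space M))"
      using B by (simp only:, intro indep_varsD[OF indep]) auto
    also have "\<dots> \<le> (\<Prod>i\<in>B. exp (- \<beta> * (t / x i)))"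
    proof (intro prod_mono conjI measure_nonneg)
      fix i assume "i \<in> B"
      with tail[of i "t / x i"] x[of i] that
      show "prob (X i -` {y. t / x i < \<bar>y\<bar>} \<inter> space M) \<le> exp (- \<beta> * (t / x i))"
        by (simp add: vimage_def Int_def conj_commute)
    qed
    also have "\<dots> = exp (- (\<beta> * (\<Sum>i\<in>B. 1 / x i)) * t)"
      using B by (simp add: exp_sum[symmetric] sum_distrib_left sum_distrib_right sum_negf)
    finally show ?thesis .
  qed
  from moment_le_Gamma[OF Y \<open>0 < p\<close> pos nonneg this]
  show "integrable M ?Y" "expectation ?Y \<le> Gamma (1 + p) * (1 / (\<beta> * (\<Sum>i\<in>B. 1 / x i))) powr p"
    by auto
qed

section \<open>Lower bounds for the expected \<open>j\<close>-th minimum\<close>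

lemma (in prob_space) integrable_jmin:
  assumes "1 \<le> j" "j \<le> n" and int: "\<And>i. i \<in> {1..n} \<Longrightarrow> integrable M (Y i)"
    and nonneg: "\<And>i \<omega>. i \<in> {1..n} \<Longrightarrow> 0 \<le> Y i \<omega>"
  shows "integrable M (\<lambda>\<omega>. jmin j n (\<lambda>i. Y i \<omega>))"
proof (rule Bochner_Integration.integrable_bound)
  show "integrable M (\<lambda>\<omega>. \<Sum>i\<in>{1..n}. Y i \<omega>)"
    using int by (intro Bochner_Integration.integrable_sum) auto
  show "(\<lambda>\<omega>. jmin j n (\<lambda>i. Y i \<omega>)) \<in> borel_measurable M"
    using assms by (intro borel_measurable_jmin) auto
  have "norm (jmin j n (\<lambda>i. Y i \<omega>)) \<le> norm (\<Sum>i\<in>{1..n}. Y i \<omega>)" for \<omega>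
  proof -
    have "Y i \<omega> \<le> (\<Sum>i\<in>{1..n}. Y i \<omega>)" if "i \<in> {1..n}" for i
      using that nonneg by (intro member_le_sum) auto
    then have "{i \<in> {1..n}. Y i \<omega> \<le> (\<Sum>i\<in>{1..n}. Y i \<omega>)} = {1..n}"
      by auto
    then have "jmin j n (\<lambda>i. Y i \<omega>) \<le> (\<Sum>i\<in>{1..n}. Y i \<omega>)"
      using assms(1,2) by (subst jmin_le_iff) auto
    moreover have "0 \<le> jmin j n (\<lambda>i. Y i \<omega>)"
      using assms by (intro jmin_nonneg) auto
    ultimately show ?thesis by simp
  qed
  then show "AE \<omega> in M. norm (jmin j n (\<lambda>i. Y i \<omega>)) \<le> norm (\<Sum>i\<in>{1..n}. Y i \<omega>)"
    by simp
qed

text \<open>Markov's inequality, built into the integrable minorant \<open>?L\<close>. The first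
  \<open>m\<close> indices are written off as possibly small, so at least \<open>j - m\<close> small
  values must come from the others.\<close>

lemma (in prob_space) expectation_jmin_ge:
  fixes m :: nat
  assumes "m < j" "j \<le> n" "0 < p" "0 < \<alpha>" and x: "\<And>i. i \<in> {1..n} \<Longrightarrow> 0 < x i"
    and meas: "\<And>i. i \<in> {1..n} \<Longrightarrow> X i \<in> borel_measurable M"
    and int: "\<And>i. i \<in> {1..n} \<Longrightarrow> integrable M (\<lambda>\<omega>. \<bar>x i * X i \<omega>\<bar> powr p)"
    and small: "\<And>i t. i \<in> {1..n} \<Longrightarrow> 0 \<le> t \<Longrightarrow> prob {\<omega> \<in> space M. \<bar>X i \<omega>\<bar> \<le> t} \<le> \<alpha> * t"
  shows "1 / 2 * ((real j - real m) / (2 * \<alpha> * (\<Sum>i=m+1..n. 1 / x i))) powr p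
    \<le> expectation (\<lambda>\<omega>. jmin j n (\<lambda>i. \<bar>x i * X i \<omega>\<bar> powr p))"
proof -
  define S where "S = (\<Sum>i=m+1..n. 1 / x i)"
  \<comment> \<open>At this level the bound \<open>\<alpha> * t * S\<close> on the expected number
    of small values is exactly half of \<open>j - m\<close>.\<close>
  define t where "t = (real j - real m) / (2 * \<alpha> * S)"
  have "0 < S"
    unfolding S_def using assms(1,2) x by (intro sum_pos) auto
  then have t: "0 < t"
    using assms(1,4) by (simp add: t_def)
  let ?J = "\<lambda>\<omega>. jmin j n (\<lambda>i. \<bar>x i * X i \<omega>\<bar> powr p)"
  let ?A = "\<lambda>i. {\<omega> \<in> space M. \<bar>X i \<omega>\<bar> \<le> t / x i}"
  \<comment> \<open>If the \<open>j\<close>-th minimum is at most \<open>t powr p\<close>, the count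
    reaches \<open>j - m\<close> and \<open>?L\<close> is nonpositive; in any case \<open>?L\<close>
    is at most \<open>t powr p\<close>.\<close>
  let ?L = "\<lambda>\<omega>. t powr p * (1 - (\<Sum>i=m+1..n. indicator (?A i) \<omega>) / (real j - real m))"
  have A: "?A i \<in> events" if "i \<in> {m+1..n}" for i
  proof -
    have [measurable]: "X i \<in> borel_measurable M"
      using meas that by simp
    show ?thesis by measurable
  qed
  have le: "?L \<omega> \<le> ?J \<omega>" if \<omega>: "\<omega> \<in> space M" for \<omega>
  proof (cases "?J \<omega> \<le> t powr p")
    case True
    have iff: "\<bar>x i * X i \<omega>\<bar> powr p \<le> t powr p \<longleftrightarrow> \<bar>X i \<omega>\<bar> \<le> t / x i" if "i \<in> {1..n}" for i
      using scaled_powr_less_iff[of t "x i" p "X i \<omega>"] x[OF that] t \<open>0 < p\<close> by linarith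
    have "j \<le> card {i \<in> {1..n}. \<bar>x i * X i \<omega>\<bar> powr p \<le> t powr p}"
      using True assms(1,2) by (subst (asm) jmin_le_iff) auto
    also have "\<dots> \<le> card ({1..m} \<union> {i \<in> {m+1..n}. \<bar>X i \<omega>\<bar> \<le> t / x i})"
      using iff by (intro card_mono) auto
    also have "\<dots> \<le> m + card {i \<in> {m+1..n}. \<bar>X i \<omega>\<bar> \<le> t / x i}"
      using card_Un_le[of "{1..m}"] by simp
    finally have "j \<le> m + card {i \<in> {m+1..n}. \<bar>X i \<omega>\<bar> \<le> t / x i}" .
    moreover have "real (card {i \<in> {m+1..n}. \<bar>X i \<omega>\<bar> \<le> t / x i}) = (\<Sum>i=m+1..n. indicator (?A i) \<omega>)"
      using \<omega> by (simp add: indicator_def sum.If_cases Int_def)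
    ultimately have "real j - real m \<le> (\<Sum>i=m+1..n. indicator (?A i) \<omega>)"
      by linarith
    then have "?L \<omega> \<le> 0"
      using assms(1) by (intro mult_nonneg_nonpos) (auto simp: field_simps)
    also have "0 \<le> ?J \<omega>"
      using assms(1,2) by (intro jmin_nonneg) auto
    finally show ?thesis .
  next
    case False
    have "?L \<omega> \<le> t powr p * 1"
      using assms(1) by (intro mult_left_mono) (auto intro!: divide_nonneg_nonneg sum_nonneg)
    with False show ?thesis by simp
  qed
  have "(\<Sum>i=m+1..n. prob (?A i)) \<le> (\<Sum>i=m+1..n. \<alpha> * (t / x i))"
  proof (intro sum_mono)
    fix i assume "i \<in> {m+1..n}"
    then have "i \<in> {1..n}" by auto
    with small[of i "t / x i"] x[of i] t show "prob (?A i) \<le> \<alpha> * (t / x i)" by simp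
  qed
  also have "\<dots> = \<alpha> * t * S"
    by (simp add: S_def sum_distrib_left)
  also have "\<dots> = (real j - real m) / 2"
    using \<open>0 < S\<close> \<open>0 < \<alpha>\<close> by (simp add: t_def field_simps)
  finally have half: "(\<Sum>i=m+1..n. prob (?A i)) / (real j - real m) \<le> 1 / 2"
    using assms(1) by (simp add: field_simps)
  have ind: "integrable M (\<lambda>\<omega>. indicator (?A i) \<omega> :: real)" if "i \<in> {m+1..n}" for i
    using A[OF that] by (intro integrable_real_indicator) (auto simp: emeasure_eq_measure)
  let ?N = "\<lambda>\<omega>. \<Sum>i=m+1..n. indicator (?A i) \<omega> :: real"
  have intN: "integrable M ?N" and exN: "expectation ?N = (\<Sum>i=m+1..n. prob (?A i))"
    using ind A by (auto simp: Bochner_Integration.integral_sum)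
  have intL: "integrable M ?L"
    using intN by (intro integrable_mult_right Bochner_Integration.integrable_diff integrable_divide) auto
  have "t powr p * (1 / 2) \<le> t powr p * (1 - (\<Sum>i=m+1..n. prob (?A i)) / (real j - real m))"
    using half by (intro mult_left_mono) auto
  also have "\<dots> = expectation ?L"
    using intN exN by (simp add: Bochner_Integration.integral_diff prob_space)
  also have "\<dots> \<le> expectation ?J"
  proof (rule integral_mono[OF intL _ le])
    show "integrable M ?J"
      using assms(1,2) int by (intro integrable_jmin) auto
  qed
  finally show ?thesis by (simp add: t_def S_def)
qed

section \<open>Blocks of balanced weight\<close>

text \<open>The blocks and the sizes \<open>d i\<close> below govern the estimate from both sides: block \<open>B i\<close> gives
  the upper bound, while, up to a constant factor, \<open>d i\<close> bounds the \<open>j\<close>-th minimum from below,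
  \<open>j = (k + i + 1) div 2\<close>. The indices before the cutoff \<open>m\<close> have weight \<open>1 / x i\<close>
  too large for an even distribution of the tail and form blocks of their own.\<close>

lemma exists_balanced_blocks:
  fixes x :: "nat \<Rightarrow> real"
  assumes "1 \<le> k" "k \<le> n" "mono_on {1..n} x" and pos: "\<And>i. i \<in> {1..n} \<Longrightarrow> 0 < x i"
  obtains B d where
    "\<And>i. i \<in> {1..k} \<Longrightarrow> 0 < d i"
    "\<And>i. i \<in> {1..k} \<Longrightarrow> B i \<subseteq> {1..n}"
    "\<And>i. i \<in> {1..k} \<Longrightarrow> 1 / (2 * d i) \<le> (\<Sum>l\<in>B i. 1 / x l)"
    "disjoint_family_on B {1..k}"
    "\<And>i. i \<in> {1..k} \<Longrightarrow> \<exists>q<(k + i + 1) div 2.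
       d i / 2 \<le> (real ((k + i + 1) div 2) - real q) / (\<Sum>l=q+1..n. 1 / x l)"
proof -
  define S where "S q = (\<Sum>l=q+1..n. 1 / x l)" for q :: nat
  \<comment> \<open>\<open>P q\<close> says that \<open>1 / x (q + 1)\<close>, the largest weight
    after \<open>q\<close>, is at most the average weight \<open>S q / (k - q)\<close> of
    \<open>k - q\<close> blocks.\<close>
  define P where "P q \<longleftrightarrow> q < k \<and> (real k - real q) / x (q + 1) \<le> S q" for q
  define m where "m = (LEAST q. P q)"
  have Spos: "0 < S q" if "q < k" for q
    unfolding S_def using assms(2) that pos by (intro sum_pos) auto
  \<comment> \<open>For \<open>q = k - 1\<close> there is one block, and its weight
    \<open>S (k - 1)\<close> contains the term \<open>1 / x k\<close>. Hence a least
    \<open>m\<close> exists.\<close>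
  have "1 / x k \<le> S (k - 1)"
    unfolding S_def using assms(1,2) pos
    by (intro member_le_sum[of k "{k - 1 + 1..n}" "\<lambda>l. 1 / x l"]) (auto intro: less_imp_le)
  then have "P (k - 1)"
    using assms(1) by (simp add: P_def of_nat_diff)
  then have "P m" and least: "\<And>q. q < m \<Longrightarrow> \<not> P q"
    unfolding m_def by (auto intro: LeastI dest: not_less_Least)
  then have m: "m < k" "(real k - real m) / x (m + 1) \<le> S m"
    by (auto simp: P_def)
  \<comment> \<open>The reciprocal of the average block weight after \<open>m\<close>; every block
    will receive at least half of that average.\<close>
  define D where "D = (real k - real m) / S m"
  have D: "0 < D"
    using m Spos by (simp add: D_def)
  have wle: "1 / x l \<le> 1 / D" if "l \<in> {m+1..n}" for l
  proof -
    have "x (m + 1) \<le> x l"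
      using that mono_onD[OF assms(3), of "m + 1" l] by simp
    then have "1 / x l \<le> 1 / x (m + 1)"
      using that pos[of "m + 1"] by (intro divide_left_mono) auto
    also have "1 / x (m + 1) \<le> 1 / D"
      using m Spos[of m] by (simp add: D_def field_simps)
    finally show ?thesis .
  qed
  have sum: "real (k - m) * (1 / D) \<le> (\<Sum>l\<in>{m+1..n}. 1 / x l)"
    using m Spos[of m] unfolding D_def S_def by (simp add: of_nat_diff)
  have "\<exists>C. (\<forall>l<k - m. C l \<subseteq> {m+1..n} \<and> 1 / D / 2 \<le> (\<Sum>i\<in>C l. 1 / x i)) \<and>
      disjoint_family_on C {..<k - m}"
    by (rule exists_disjoint_blocks[OF _ wle _ sum]) (use D in auto)
  then obtain C where C: "\<And>l. l < k - m \<Longrightarrow> C l \<subseteq> {m+1..n}"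
      "\<And>l. l < k - m \<Longrightarrow> 1 / D / 2 \<le> (\<Sum>i\<in>C l. 1 / x i)"
      "disjoint_family_on C {..<k - m}"
    by blast
  have C1: "C (l - m - 1) \<subseteq> {m+1..n}" if "l \<in> {1..k}" "\<not> l \<le> m" for l
    using that by (intro C(1)) auto
  \<comment> \<open>\<open>C\<close> is indexed from 0 and follows the \<open>m\<close> singletons,
    hence the shift \<open>i - m - 1\<close>.\<close>
  define B where "B i = (if i \<le> m then {i} else C (i - m - 1))" for i
  define d where "d i = (if i \<le> m then x i else D)" for i
  show thesis
  proof
    fix i assume i: "i \<in> {1..k}"
    show "0 < d i"
      using i assms(2) pos D by (auto simp: d_def)
    show "B i \<subseteq> {1..n}"
    proof (cases "i \<le> m")
      case False
      with i C1[of i] show ?thesis by (auto simp: B_def)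
    qed (use i assms(2) in \<open>auto simp: B_def\<close>)
    show "1 / (2 * d i) \<le> (\<Sum>l\<in>B i. 1 / x l)"
    proof (cases "i \<le> m")
      case True
      with i assms(2) pos[of i] show ?thesis
        by (simp add: B_def d_def field_simps)
    next
      case False
      with i C(2)[of "i - m - 1"] show ?thesis
        by (simp add: B_def d_def mult.commute)
    qed
    show "\<exists>q<(k + i + 1) div 2.
       d i / 2 \<le> (real ((k + i + 1) div 2) - real q) / (\<Sum>l=q+1..n. 1 / x l)"
    proof (cases "i \<le> m")
      case True
      have Si: "0 < S (i - 1)"
        using i by (intro Spos) auto
      \<comment> \<open>Minimality of \<open>m\<close> reverses the inequality in \<open>P\<close>
        at \<open>q = i - 1\<close>, which bounds \<open>x i\<close> from above; this
        \<open>q\<close> is also the witness.\<close>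
      have "\<not> P (i - 1)"
        using i True by (intro least) auto
      then have "S (i - 1) < (real k - real (i - 1)) / x i"
        using i by (auto simp: P_def)
      then have "x i \<le> (real k - real (i - 1)) / S (i - 1)"
        using i assms(2) pos[of i] Si by (simp add: field_simps)
      also have "\<dots> / 2 \<le> (real ((k + i + 1) div 2) - real (i - 1)) / S (i - 1)"
      proof -
        \<comment> \<open>The rank \<open>(k + i + 1) div 2\<close> is at least
          \<open>(k + i) / 2\<close>, so subtracting \<open>i - 1\<close> leaves at least half of
          \<open>k - (i - 1)\<close>.\<close>
        have "(real k - real (i - 1)) / 2 \<le> real ((k + i + 1) div 2) - real (i - 1)"
          using i by (simp add: of_nat_diff)
        then have "(real k - real (i - 1)) / 2 / S (i - 1)
            \<le> (real ((k + i + 1) div 2) - real (i - 1)) / S (i - 1)"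
          using Si by (intro divide_right_mono) auto
        then show ?thesis by (simp add: mult.commute)
      qed
      finally have "x i / 2 \<le> (real ((k + i + 1) div 2) - real (i - 1)) / S (i - 1)"
        by simp
      then show ?thesis
        using i True by (intro exI[of _ "i - 1"]) (auto simp: d_def S_def)
    next
      case False
      \<comment> \<open>Here the witness is \<open>m\<close>; since \<open>m < i\<close>, the rank
        is at least \<open>(k + m) / 2\<close>.\<close>
      have "(real k - real m) / 2 \<le> real j - real m" if "k + m \<le> 2 * j" for j
        using of_nat_mono[OF that, where 'a = real] by simp
      moreover have "k + m \<le> 2 * ((k + i + 1) div 2)"
        using False by presburger
      ultimately have "(real k - real m) / 2 \<le> real ((k + i + 1) div 2) - real m"
        by blast
      then have "(real k - real m) / 2 / S m \<le> (real ((k + i + 1) div 2) - real m) / S m"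
        using Spos[OF m(1)] by (intro divide_right_mono) auto
      then show ?thesis
        using i False m by (intro exI[of _ m]) (auto simp: d_def D_def S_def mult.commute)
    qed
  next
    show "disjoint_family_on B {1..k}"
      unfolding disjoint_family_on_def
    proof (intro ballI impI)
      fix i i' assume i: "i \<in> {1..k}" "i' \<in> {1..k}" "i \<noteq> i'"
      consider "i \<le> m" "i' \<le> m" | "i \<le> m" "\<not> i' \<le> m" | "\<not> i \<le> m" "i' \<le> m"
        | "\<not> i \<le> m" "\<not> i' \<le> m" by blast
      then show "B i \<inter> B i' = {}"
      proof cases
        case 4
        with i have "i - m - 1 < k - m" "i' - m - 1 < k - m" "i - m - 1 \<noteq> i' - m - 1"
          by auto
        with C(3) 4 show ?thesis
          unfolding disjoint_family_on_def B_def by auto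
      qed (use i C1[of i] C1[of i'] in \<open>auto simp: B_def\<close>)
    qed
  qed
qed

section \<open>Comparison of the two expectations\<close>

text \<open>Both expectations are compared with the sum of \<open>d i powr p\<close>: block minima
  bound the one for \<open>\<xi>\<close> from above, the ranks \<open>(k + i + 1) div 2\<close> the
  one for \<open>\<eta>\<close> from below. Nonnegativity serves to enlarge the constant
  later.\<close>

lemma (in prob_space) expected_min_sum_le:
  assumes "0 < p" "0 < \<alpha>" "0 < \<beta>" "1 \<le> k" "k \<le> n" "0 < x 1" "mono_on {1..n} x"
    and \<xi>: "\<And>i. i \<in> {1..n} \<Longrightarrow> \<xi> i \<in> borel_measurable M"
      "\<And>i. i \<in> {1..n} \<Longrightarrow> alpha_beta_condition M \<alpha> \<beta> (\<xi> i)"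
    and \<eta>: "\<And>i. i \<in> {1..n} \<Longrightarrow> \<eta> i \<in> borel_measurable M"
      "\<And>i. i \<in> {1..n} \<Longrightarrow> alpha_beta_condition M \<alpha> \<beta> (\<eta> i)"
    and indep: "indep_vars (\<lambda>_. borel) \<xi> {1..n}"
  shows "0 \<le> expected_min_sum M p k n x \<eta>"
    and "expected_min_sum M p k n x \<xi> \<le>
      4 * (8 * \<alpha> / \<beta>) powr p * Gamma (1 + p) * expected_min_sum M p k n x \<eta>"
proof -
  have pos: "0 < x i" if "i \<in> {1..n}" for i
    using mono_onD[OF assms(7), of 1 i] that assms(6) by fastforce
  obtain B d where d: "\<And>i. i \<in> {1..k} \<Longrightarrow> 0 < d i"
    and B: "\<And>i. i \<in> {1..k} \<Longrightarrow> B i \<subseteq> {1..n}"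
      "\<And>i. i \<in> {1..k} \<Longrightarrow> 1 / (2 * d i) \<le> (\<Sum>l\<in>B i. 1 / x l)"
      "disjoint_family_on B {1..k}"
    and low: "\<And>i. i \<in> {1..k} \<Longrightarrow> \<exists>q<(k + i + 1) div 2.
       d i / 2 \<le> (real ((k + i + 1) div 2) - real q) / (\<Sum>l=q+1..n. 1 / x l)"
    using exists_balanced_blocks[OF assms(4,5,7) pos] by metis
  have Bne: "B i \<noteq> {}" if "i \<in> {1..k}" for i
    using B(2)[OF that] d[OF that] by (auto simp: field_simps)
  have fin: "finite (B i)" if "i \<in> {1..k}" for i
    using B(1)[OF that] finite_subset by blast
  define J where "J X j = (\<lambda>\<omega>. jmin j n (\<lambda>i. \<bar>x i * X i \<omega>\<bar> powr p))"
    for X :: "nat \<Rightarrow> 'a \<Rightarrow> real" and j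
  define E where "E X j = expectation (J X j)" for X :: "nat \<Rightarrow> 'a \<Rightarrow> real" and j
  have int: "integrable M (\<lambda>\<omega>. \<bar>x i * X i \<omega>\<bar> powr p)"
    if "i \<in> {1..n}" "X i \<in> borel_measurable M" "alpha_beta_condition M \<alpha> \<beta> (X i)"
    for X :: "nat \<Rightarrow> 'a \<Rightarrow> real" and i
    using that pos[of i] assms(1,3)
    by (intro integrable_scaled_powr[of "X i" p \<beta>]) (auto simp: alpha_beta_condition_def)
  have intJ: "integrable M (J X j)"
    if "j \<in> {1..k}" "\<And>i. i \<in> {1..n} \<Longrightarrow> X i \<in> borel_measurable M"
      "\<And>i. i \<in> {1..n} \<Longrightarrow> alpha_beta_condition M \<alpha> \<beta> (X i)"
    for X :: "nat \<Rightarrow> 'a \<Rightarrow> real" and j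
    unfolding J_def using that int assms(5) by (intro integrable_jmin) auto
  have Jnn: "0 \<le> J X j \<omega>" if "j \<in> {1..k}" for X :: "nat \<Rightarrow> 'a \<Rightarrow> real" and j \<omega>
    unfolding J_def using that assms(5) by (intro jmin_nonneg) auto
  then have Enn: "0 \<le> E X j" if "j \<in> {1..k}" for X :: "nat \<Rightarrow> 'a \<Rightarrow> real" and j
    unfolding E_def using that by (intro Bochner_Integration.integral_nonneg) auto
  have "expected_min_sum M p k n x \<eta> = expectation (\<lambda>\<omega>. \<Sum>j=1..k. J \<eta> j \<omega>)"
    by (simp add: expected_min_sum_def J_def)
  also have "\<dots> = (\<Sum>j=1..k. E \<eta> j)"
    unfolding E_def using intJ \<eta> by (intro Bochner_Integration.integral_sum) auto
  finally have eq: "expected_min_sum M p k n x \<eta> = (\<Sum>j=1..k. E \<eta> j)" .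
  show nn: "0 \<le> expected_min_sum M p k n x \<eta>"
    unfolding eq using Enn by (intro sum_nonneg) auto

  \<comment> \<open>The 4 combines \<open>d i / 2\<close> from the balanced blocks with
    \<open>2 * \<alpha>\<close> from the Markov bound.\<close>
  have lower: "1 / 2 * (d i / (4 * \<alpha>)) powr p \<le> E \<eta> ((k + i + 1) div 2)" if i: "i \<in> {1..k}" for i
  proof -
    define j where "j = (k + i + 1) div 2"
    from low[OF i] obtain q where q: "q < j"
      "d i / 2 \<le> (real j - real q) / (\<Sum>l=q+1..n. 1 / x l)"
      unfolding j_def by blast
    have "d i / 2 / (2 * \<alpha>) \<le> (real j - real q) / (\<Sum>l=q+1..n. 1 / x l) / (2 * \<alpha>)"
      using q assms(2) by (intro divide_right_mono) auto
    then have "d i / (4 * \<alpha>) \<le> (real j - real q) / (2 * \<alpha> * (\<Sum>l=q+1..n. 1 / x l))"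
      by (simp add: mult.commute)
    then have "1 / 2 * (d i / (4 * \<alpha>)) powr p \<le>
        1 / 2 * ((real j - real q) / (2 * \<alpha> * (\<Sum>l=q+1..n. 1 / x l))) powr p"
      using d[OF i] assms(1,2) by (intro mult_left_mono powr_mono2) auto
    also have "\<dots> \<le> E \<eta> j"
      unfolding E_def J_def using q i assms(1,2,5) pos \<eta> int
      by (intro expectation_jmin_ge) (auto simp: j_def alpha_beta_condition_def)
    finally show ?thesis by (simp add: j_def)
  qed
  \<comment> \<open>The resulting factor 4 has one 2 from the probability \<open>1 / 2\<close> and
    one from ranks being hit up to twice.\<close>
  have "(\<Sum>i=1..k. 1 / 2 * (d i / (4 * \<alpha>)) powr p) \<le> (\<Sum>i=1..k. E \<eta> ((k + i + 1) div 2))"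
    by (intro sum_mono lower)
  also have "\<dots> \<le> 2 * expected_min_sum M p k n x \<eta>"
    unfolding eq using Enn by (rule sum_upper_half_le)
  finally have sum_d: "(\<Sum>i=1..k. (d i / (4 * \<alpha>)) powr p) \<le> 4 * expected_min_sum M p k n x \<eta>"
    by (simp add: sum_divide_distrib[symmetric])

  let ?Y = "\<lambda>i \<omega>. Min ((\<lambda>l. \<bar>x l * \<xi> l \<omega>\<bar> powr p) ` B i)"
  have Y: "integrable M (?Y i)"
    "expectation (?Y i) \<le> Gamma (1 + p) * (1 / (\<beta> * (\<Sum>l\<in>B i. 1 / x l))) powr p"
    if i: "i \<in> {1..k}" for i
    by (rule Min_moment_le[OF indep B(1)[OF i] fin[OF i] Bne[OF i] assms(1,3)];
        use i B(1)[OF i] pos \<xi> in \<open>auto simp: alpha_beta_condition_def\<close>)+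
  have upper: "expectation (?Y i) \<le>
      Gamma (1 + p) * (8 * \<alpha> / \<beta>) powr p * (d i / (4 * \<alpha>)) powr p" if i: "i \<in> {1..k}" for i
  proof -
    \<comment> \<open>Block weight at least \<open>1 / (2 * d i)\<close> means an exponential mean
      of at most \<open>2 * d i / \<beta>\<close>, rewritten with the quantity
      \<open>d i / (4 * \<alpha>)\<close> of the lower bound.\<close>
    have "1 / (\<beta> * (\<Sum>l\<in>B i. 1 / x l)) \<le> 1 / (\<beta> * (1 / (2 * d i)))"
      using B(2)[OF i] d[OF i] assms(3)
      by (intro divide_left_mono mult_left_mono mult_pos_pos) (auto intro: less_le_trans[rotated])
    also have "\<dots> = 8 * \<alpha> / \<beta> * (d i / (4 * \<alpha>))"
      using assms(2,3) by (simp add: field_simps)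
    finally have le: "1 / (\<beta> * (\<Sum>l\<in>B i. 1 / x l)) \<le> 8 * \<alpha> / \<beta> * (d i / (4 * \<alpha>))" .
    have "0 \<le> (\<Sum>l\<in>B i. 1 / x l)"
    proof (intro sum_nonneg)
      fix l assume "l \<in> B i"
      then have "l \<in> {1..n}" using B(1)[OF i] by blast
      then show "0 \<le> 1 / x l" using pos[of l] by simp
    qed
    then have "(1 / (\<beta> * (\<Sum>l\<in>B i. 1 / x l))) powr p \<le> (8 * \<alpha> / \<beta> * (d i / (4 * \<alpha>))) powr p"
      using le assms(1,3) by (intro powr_mono2) auto
    also have "\<dots> = (8 * \<alpha> / \<beta>) powr p * (d i / (4 * \<alpha>)) powr p"
      by (rule powr_mult)
    finally have "Gamma (1 + p) * (1 / (\<beta> * (\<Sum>l\<in>B i. 1 / x l))) powr p \<le>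
        Gamma (1 + p) * ((8 * \<alpha> / \<beta>) powr p * (d i / (4 * \<alpha>)) powr p)"
      using assms(1) by (intro mult_left_mono) (auto intro!: Gamma_real_nonneg)
    with Y(2)[OF i] show ?thesis by simp
  qed
  have "expected_min_sum M p k n x \<xi> \<le> expectation (\<lambda>\<omega>. \<Sum>i=1..k. ?Y i \<omega>)"
    unfolding expected_min_sum_def
  proof (rule integral_mono)
    show "integrable M (\<lambda>\<omega>. \<Sum>j=1..k. jmin j n (\<lambda>i. \<bar>x i * \<xi> i \<omega>\<bar> powr p))"
      using intJ[of _ \<xi>] \<xi> unfolding J_def by (intro Bochner_Integration.integrable_sum) auto
    show "integrable M (\<lambda>\<omega>. \<Sum>i=1..k. ?Y i \<omega>)"
      using Y(1) by (intro Bochner_Integration.integrable_sum) auto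
  qed (use B Bne in \<open>intro sum_jmin_le_sum_Min; auto\<close>)
  also have "\<dots> = (\<Sum>i=1..k. expectation (?Y i))"
    using Y(1) by (intro Bochner_Integration.integral_sum) auto
  also have "\<dots> \<le> (\<Sum>i=1..k. Gamma (1 + p) * (8 * \<alpha> / \<beta>) powr p * (d i / (4 * \<alpha>)) powr p)"
    by (intro sum_mono upper)
  also have "\<dots> = Gamma (1 + p) * (8 * \<alpha> / \<beta>) powr p * (\<Sum>i=1..k. (d i / (4 * \<alpha>)) powr p)"
    by (rule sum_distrib_left[symmetric])
  also have "\<dots> \<le> Gamma (1 + p) * (8 * \<alpha> / \<beta>) powr p * (4 * expected_min_sum M p k n x \<eta>)"
    using sum_d assms(1) by (intro mult_left_mono) (auto intro!: Gamma_real_nonneg mult_nonneg_nonneg)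
  finally show "expected_min_sum M p k n x \<xi> \<le>
      4 * (8 * \<alpha> / \<beta>) powr p * Gamma (1 + p) * expected_min_sum M p k n x \<eta>"
    by (simp add: mult_ac)
qed

section \<open>The Gaussian case\<close>

text \<open>In the Gamma integral, \<open>u \<le> exp u\<close> at \<open>u = t / (3 * p)\<close>
  gives \<open>t powr p \<le> (3 * p) powr p * exp (t / 3)\<close>. What remains is the integral of
  \<open>exp (- (2 / 3) * t)\<close>, equal to \<open>3 / 2\<close>.\<close>

lemma Gamma_le_powr:
  fixes p :: real
  assumes "0 < p"
  shows "Gamma (1 + p) \<le> 3 / 2 * (3 * p) powr p"
proof (rule has_integral_le)
  show "((\<lambda>t. t powr (1 + p - 1) / exp t) has_integral Gamma (1 + p)) {0..}"
    using assms by (intro Gamma_integral_real) auto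
  have "((\<lambda>t. (3 * p) powr p * exp (- (2 / 3) * t)) has_integral
      (3 * p) powr p * (exp (- (2 / 3) * 0) / (2 / 3))) {0..}"
    by (intro has_integral_mult_right has_integral_exp_minus_to_infinity) simp
  then show "((\<lambda>t. (3 * p) powr p * exp (- (2 / 3) * t)) has_integral 3 / 2 * (3 * p) powr p) {0..}"
    by (simp add: mult.commute)
next
  fix t :: real assume "t \<in> {0..}"
  then have t: "0 \<le> t" by simp
  define u where "u = t / (3 * p)"
  have u: "0 \<le> u" "t = 3 * p * u"
    using t assms by (auto simp: u_def)
  have "u \<le> exp u"
    using exp_ge_add_one_self[of u] by linarith
  then have le: "u powr p \<le> exp u powr p"
    using u(1) assms by (intro powr_mono2) auto
  have "t powr p = (3 * p) powr p * u powr p"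
    unfolding u(2) by (rule powr_mult)
  also note le
  also have "exp u powr p = exp (t / 3)"
    by (simp add: powr_def u(2) mult_ac)
  finally have "t powr p \<le> (3 * p) powr p * exp (t / 3)"
    by (simp add: mult_left_mono)
  then have "t powr p / exp t \<le> (3 * p) powr p * exp (t / 3) / exp t"
    by (intro divide_right_mono) auto
  also have "\<dots> = (3 * p) powr p * exp (- (2 / 3) * t)"
  proof -
    have "t / 3 - t = - (2 / 3) * t" by simp
    then show ?thesis by (metis exp_diff times_divide_eq_right)
  qed
  finally show "t powr (1 + p - 1) / exp t \<le> (3 * p) powr p * exp (- (2 / 3) * t)"
    by simp
qed

text \<open>On the positive axis the density of \<open>\<bar>X\<bar>\<close>, \<open>X\<close> standard normal, is \<open>c * exp (- x\<^sup>2 / 2)\<close>;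
  it crosses the exponential density \<open>c * exp (- c * x)\<close> only at \<open>x = 2 * c\<close>, from above to below.\<close>

lemma
  defines "c \<equiv> sqrt (2 / pi)"
  assumes A [measurable]: "A \<in> sets borel"
  shows measure_exponential_le_std_normal:
      "A \<subseteq> {0..2 * c} \<Longrightarrow> measure (density lborel (exponential_density c)) A
        \<le> 2 * measure (density lborel std_normal_density) A"
    and measure_std_normal_le_exponential:
      "A \<subseteq> {2 * c..} \<Longrightarrow> 2 * measure (density lborel std_normal_density) A
        \<le> measure (density lborel (exponential_density c)) A"
proof -
  have c: "0 < c" by (simp add: c_def)
  have half: "2 * std_normal_density x = c * exp (- x\<^sup>2 / 2)" for x
    by (simp add: std_normal_density_def c_def real_sqrt_divide real_sqrt_mult real_div_sqrt field_simps)
  let ?E = "density lborel (exponential_density c)" and ?N = "density lborel std_normal_density"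
  interpret E: prob_space ?E using c by (rule prob_space_exponential_density)
  interpret N: prob_space ?N by (rule prob_space_normal_density) simp
  have eqE: "ennreal (measure ?E A) = (\<integral>\<^sup>+ x. ennreal (exponential_density c x) * indicator A x \<partial>lborel)"
    unfolding E.emeasure_eq_measure[symmetric] by (subst emeasure_density) auto
  have eqN: "ennreal (2 * measure ?N A) = (\<integral>\<^sup>+ x. ennreal (2 * std_normal_density x) * indicator A x \<partial>lborel)"
  proof -
    have "ennreal (2 * measure ?N A) = 2 * emeasure ?N A"
      by (simp add: ennreal_mult N.emeasure_eq_measure)
    also have "\<dots> = (\<integral>\<^sup>+ x. 2 * (ennreal (std_normal_density x) * indicator A x) \<partial>lborel)"
      by (subst emeasure_density) (auto simp: nn_integral_cmult)
    also have "\<dots> = (\<integral>\<^sup>+ x. ennreal (2 * std_normal_density x) * indicator A x \<partial>lborel)"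
      by (intro nn_integral_cong) (simp add: ennreal_mult mult.assoc)
    finally show ?thesis .
  qed
  show "measure ?E A \<le> 2 * measure ?N A" if "A \<subseteq> {0..2 * c}"
  proof -
    have "exponential_density c x \<le> 2 * std_normal_density x" if "x \<in> A" for x
    proof -
      have x: "0 \<le> x" "x \<le> 2 * c" using that \<open>A \<subseteq> _\<close> by auto
      \<comment> \<open>This compares the exponents, \<open>- c * x \<le> - x\<^sup>2 / 2\<close>;
        the prefactors of the two densities agree.\<close>
      then have "x * x \<le> 2 * c * x" by (intro mult_right_mono)
      then show ?thesis
        unfolding half using x c by (auto simp: exponential_density_def power2_eq_square field_simps)
    qed
    then have "ennreal (measure ?E A) \<le> ennreal (2 * measure ?N A)"
      unfolding eqE eqN by (intro nn_integral_mono) (auto simp: indicator_def intro: ennreal_leI)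
    then show ?thesis by (subst (asm) ennreal_le_iff) auto
  qed
  show "2 * measure ?N A \<le> measure ?E A" if "A \<subseteq> {2 * c..}"
  proof -
    have "2 * std_normal_density x \<le> exponential_density c x" if "x \<in> A" for x
    proof -
      have x: "2 * c \<le> x" "0 \<le> x" using that \<open>A \<subseteq> _\<close> c by auto
      then have "2 * c * x \<le> x * x" by (intro mult_right_mono)
      then show ?thesis
        unfolding half using x c by (auto simp: exponential_density_def power2_eq_square field_simps)
    qed
    then have "ennreal (2 * measure ?N A) \<le> ennreal (measure ?E A)"
      unfolding eqE eqN by (intro nn_integral_mono) (auto simp: indicator_def intro: ennreal_leI)
    then show ?thesis by (subst (asm) ennreal_le_iff) auto
  qed
qed

lemma (in prob_space) prob_distributed_density:
  fixes X :: "'a \<Rightarrow> real" and f :: "real \<Rightarrow> real"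
  assumes "distributed M lborel X f" "A \<in> sets borel"
  shows "prob (X -` A \<inter> space M) = measure (density lborel f) A"
proof -
  have X: "X \<in> measurable M lborel" and D: "distr M lborel X = density lborel f"
    using assms(1) by (auto simp: distributed_def)
  have "measure (distr M lborel X) A = prob (X -` A \<inter> space M)"
    using X assms(2) by (intro measure_distr) auto
  then show ?thesis by (simp add: D)
qed

lemma (in prob_space) distributed_std_normal_uminus:
  assumes "distributed M lborel X std_normal_density"
  shows "distributed M lborel (\<lambda>\<omega>. - X \<omega>) std_normal_density"
  using normal_density_affine[OF assms, of "-1" 0] by simp

text \<open>Beyond the crossing point \<open>2 * c\<close> the densities compare directly. Before
  it, the reverse comparison on \<open>{0<..t}\<close> is subtracted from the masses of the positive
  half-line: at most 1 for twice the normal law, exactly 1 for the exponential law.\<close>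

lemma (in prob_space) std_normal_greaterThan_le:
  fixes X :: "'a \<Rightarrow> real"
  assumes X: "distributed M lborel X std_normal_density" and "0 \<le> t"
  defines "c \<equiv> sqrt (2 / pi)"
  shows "2 * prob (X -` {t<..} \<inter> space M) \<le> exp (- c * t)"
proof -
  have c: "0 < c" by (simp add: c_def)
  let ?E = "density lborel (exponential_density c)" and ?N = "density lborel std_normal_density"
  interpret E: prob_space ?E using c by (rule prob_space_exponential_density)
  interpret N: prob_space ?N by (rule prob_space_normal_density) simp
  have [measurable]: "X \<in> borel_measurable M"
    using X by (simp add: distributed_def)
  have exp: "measure ?E {s<..} = exp (- c * s)" if "0 \<le> s" for s
    using emeasure_exponential_greaterThan[OF c that] by (simp add: E.emeasure_eq_measure)
  show ?thesis
  proof (cases "2 * c \<le> t")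
    case True
    then have "2 * measure ?N {t<..} \<le> measure ?E {t<..}"
      unfolding c_def by (intro measure_std_normal_le_exponential) auto
    then show ?thesis
      using exp[OF \<open>0 \<le> t\<close>] by (simp add: prob_distributed_density[OF X])
  next
    case False
    note X' = distributed_std_normal_uminus[OF X]
    have "2 * measure ?N {0<..} = prob (X -` {0<..} \<inter> space M) + prob ((\<lambda>\<omega>. - X \<omega>) -` {0<..} \<inter> space M)"
      by (simp add: prob_distributed_density[OF X] prob_distributed_density[OF X'])
    also have "\<dots> = prob (X -` {0<..} \<inter> space M \<union> (\<lambda>\<omega>. - X \<omega>) -` {0<..} \<inter> space M)"
      by (rule finite_measure_Union[symmetric]) auto
    also have "\<dots> \<le> 1" by (rule prob_le_1)
    finally have pos: "2 * measure ?N {0<..} \<le> 1" .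
    have split: "measure Q {0<..} = measure Q {0<..t} + measure Q {t<..}"
      if "finite_measure Q" "sets Q = sets borel" for Q :: "real measure"
    proof -
      have "{0<..} = {0<..t} \<union> {t<..}" using \<open>0 \<le> t\<close> by auto
      then show ?thesis
        using that(2) by (simp only:) (subst finite_measure.finite_measure_Union[OF that(1)], auto)
    qed
    have "measure ?E {0<..t} \<le> 2 * measure ?N {0<..t}"
      using False unfolding c_def by (intro measure_exponential_le_std_normal) auto
    then have "2 * measure ?N {t<..} \<le> exp (- c * t)"
      using pos exp[of 0] exp[OF \<open>0 \<le> t\<close>] split[of ?N] split[of ?E] E.finite_measure_axioms
        N.finite_measure_axioms by simp
    then show ?thesis by (simp add: prob_distributed_density[OF X])
  qed
qed

text \<open>Small values: the density is at most \<open>sqrt (2 / pi) / 2\<close> on an interval of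
  length \<open>2 * t\<close>. Large values: the two-sided tail splits into the tails of
  \<open>X\<close> and \<open>- X\<close>.\<close>

lemma (in prob_space) std_normal_alpha_beta_condition:
  fixes X :: "'a \<Rightarrow> real"
  assumes X: "distributed M lborel X std_normal_density"
  shows "alpha_beta_condition M (sqrt (2 / pi)) (sqrt (2 / pi)) X"
  unfolding alpha_beta_condition_def
proof (intro conjI allI impI)
  fix t :: real assume t: "0 \<le> t"
  let ?c = "sqrt (2 / pi)"
  have [measurable]: "X \<in> borel_measurable M"
    using X by (simp add: distributed_def)
  have le: "std_normal_density x \<le> ?c / 2" for x
  proof -
    have "std_normal_density x \<le> 1 / sqrt (2 * pi) * 1"
      unfolding std_normal_density_def by (intro mult_left_mono) auto
    also have "\<dots> = ?c / 2"
      by (simp add: real_sqrt_divide real_sqrt_mult real_div_sqrt field_simps)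
    finally show ?thesis .
  qed
  have "ennreal (prob {\<omega> \<in> space M. \<bar>X \<omega>\<bar> \<le> t}) = emeasure M (X -` {-t..t} \<inter> space M)"
    unfolding emeasure_eq_measure by (intro arg_cong[where f = "\<lambda>A. ennreal (prob A)"]) auto
  also have "\<dots> = (\<integral>\<^sup>+ x. ennreal (std_normal_density x) * indicator {-t..t} x \<partial>lborel)"
    by (rule distributed_emeasure[OF X]) simp
  also have "\<dots> \<le> (\<integral>\<^sup>+ x. ennreal (?c / 2) * indicator {-t..t} x \<partial>lborel)"
    using le by (intro nn_integral_mono mult_right_mono ennreal_leI) auto
  also have "\<dots> = ennreal (?c * t)"
    using t by (subst nn_integral_cmult_indicator) (auto simp: ennreal_mult[symmetric])
  finally show "prob {\<omega> \<in> space M. \<bar>X \<omega>\<bar> \<le> t} \<le> ?c * t"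
    using t by (subst (asm) ennreal_le_iff) auto
  note X' = distributed_std_normal_uminus[OF X]
  have "prob {\<omega> \<in> space M. \<bar>X \<omega>\<bar> > t} =
      prob ((X -` {t<..} \<inter> space M) \<union> ((\<lambda>\<omega>. - X \<omega>) -` {t<..} \<inter> space M))"
    by (intro arg_cong[where f = prob]) auto
  also have "\<dots> \<le> prob (X -` {t<..} \<inter> space M) + prob ((\<lambda>\<omega>. - X \<omega>) -` {t<..} \<inter> space M)"
    by (rule measure_Un_le) auto
  also have "\<dots> \<le> exp (- ?c * t)"
    using std_normal_greaterThan_le[OF X t] std_normal_greaterThan_le[OF X' t] by simp
  finally show "prob {\<omega> \<in> space M. \<bar>X \<omega>\<bar> > t} \<le> exp (- ?c * t)" .
qed

text \<open>Since \<alpha> = \<beta>, the ratio cancels; with \<open>Gamma_le_powr\<close> the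
  constants become \<open>4 * (3 / 2) = 6\<close> and \<open>8 * 3 = 24\<close>.\<close>

lemma gaussian_comparison_24:
  assumes "prob_space M"
  shows "gaussian_comparison M 24"
  unfolding gaussian_comparison_def
proof (intro allI impI, elim conjE)
  interpret prob_space M by fact
  fix p :: real and k n :: nat and x :: "nat \<Rightarrow> real" and \<xi> \<eta> :: "nat \<Rightarrow> 'a \<Rightarrow> real"
  assume p: "0 < p" and k: "1 \<le> k" "k \<le> n" and x: "0 < x 1" "mono_on {1..n} x"
    and \<xi>: "\<forall>i\<in>{1..n}. distributed M lborel (\<xi> i) std_normal_density"
    and \<eta>: "\<forall>i\<in>{1..n}. distributed M lborel (\<eta> i) std_normal_density"
    and indep: "indep_vars (\<lambda>_. borel) \<xi> {1..n}"
  let ?c = "sqrt (2 / pi)"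
  have c: "0 < ?c" by simp
  have meas: "X \<in> borel_measurable M" if "distributed M lborel X std_normal_density" for X :: "'a \<Rightarrow> real"
    using that by (simp add: distributed_def)
  note main = expected_min_sum_le[where \<xi> = \<xi> and \<eta> = \<eta>, OF p c c k x _ _ _ _ indep]
  have nn: "0 \<le> expected_min_sum M p k n x \<eta>"
    by (rule main(1)) (use \<xi> \<eta> meas std_normal_alpha_beta_condition in blast)+
  have "expected_min_sum M p k n x \<xi> \<le>
      4 * (8 * ?c / ?c) powr p * Gamma (1 + p) * expected_min_sum M p k n x \<eta>"
    by (rule main(2)) (use \<xi> \<eta> meas std_normal_alpha_beta_condition in blast)+
  also have "\<dots> = 4 * 8 powr p * Gamma (1 + p) * expected_min_sum M p k n x \<eta>"
    by simp
  also have "\<dots> \<le> 4 * 8 powr p * (3 / 2 * (3 * p) powr p) * expected_min_sum M p k n x \<eta>"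
    using nn by (intro mult_right_mono mult_left_mono Gamma_le_powr p) auto
  also have "\<dots> = 6 * (24 * p) powr p * expected_min_sum M p k n x \<eta>"
    using powr_mult[of 8 "3 * p" p] by simp
  finally show "expected_min_sum M p k n x \<xi> \<le> 6 * (24 * p) powr p * expected_min_sum M p k n x \<eta>" .
qed

section \<open>Transfer between sample spaces\<close>

text \<open>Independence means that the joint law is a product, and the joint law of the
  \<open>X i\<close> under \<open>distr M K T\<close> is that of their composites with
  \<open>T\<close> under \<open>M\<close>.\<close>

lemma (in prob_space) indep_vars_distr:
  assumes "I \<noteq> {}" and T [measurable]: "T \<in> measurable M K"
    and X: "\<And>i. i \<in> I \<Longrightarrow> X i \<in> measurable K (M' i)"
    and indep: "indep_vars M' (\<lambda>i \<omega>. X i (T \<omega>)) I"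
  shows "prob_space.indep_vars (distr M K T) M' X I"
proof -
  interpret K: prob_space "distr M K T" by (rule prob_space_distr) fact
  have XT: "(\<lambda>\<omega>. X i (T \<omega>)) \<in> measurable M (M' i)" if "i \<in> I" for i
    using measurable_compose[OF T X[OF that]] .
  have "distr (distr M K T) (\<Pi>\<^sub>M i\<in>I. M' i) (\<lambda>y. \<lambda>i\<in>I. X i y) =
      distr M (\<Pi>\<^sub>M i\<in>I. M' i) (\<lambda>\<omega>. \<lambda>i\<in>I. X i (T \<omega>))"
    using X by (subst distr_distr) (auto simp: comp_def intro!: measurable_restrict)
  also have "\<dots> = (\<Pi>\<^sub>M i\<in>I. distr M (M' i) (\<lambda>\<omega>. X i (T \<omega>)))"
    using indep indep_vars_iff_distr_eq_PiM'[OF assms(1) XT] by simp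
  also have "\<dots> = (\<Pi>\<^sub>M i\<in>I. distr (distr M K T) (M' i) (X i))"
    using X by (intro PiM_cong) (auto simp: distr_distr comp_def)
  finally show ?thesis
    using K.indep_vars_iff_distr_eq_PiM'[OF assms(1), of X M'] X by simp
qed

text \<open>The normal laws, the independence and both expectations are determined by the joint law
  of the two families, realized here by the coordinates on
  \<open>nat \<Rightarrow> real\<close>.\<close>

lemma gaussian_comparison_transfer:
  fixes M :: "'a measure"
  assumes "prob_space M"
    and all: "\<And>N :: (nat \<Rightarrow> real) measure. prob_space N \<Longrightarrow> gaussian_comparison N C"
  shows "gaussian_comparison M C"
  unfolding gaussian_comparison_def
proof (intro allI impI, elim conjE)
  interpret prob_space M by fact
  fix p :: real and k n :: nat and x :: "nat \<Rightarrow> real" and \<xi> \<eta> :: "nat \<Rightarrow> 'a \<Rightarrow> real"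
  assume p: "0 < p" and k: "1 \<le> k" "k \<le> n" and x: "0 < x 1" "mono_on {1..n} x"
    and \<xi>: "\<forall>i\<in>{1..n}. distributed M lborel (\<xi> i) std_normal_density"
    and \<eta>: "\<forall>i\<in>{1..n}. distributed M lborel (\<eta> i) std_normal_density"
    and indep: "indep_vars (\<lambda>_. borel) \<xi> {1..n}"
  let ?K = "\<Pi>\<^sub>M j\<in>(UNIV :: nat set). (borel :: real measure)"
  \<comment> \<open>Coordinates 1 to \<open>n\<close> carry the \<open>\<xi> i\<close>, coordinates
    \<open>n + 1\<close> to \<open>2 * n\<close> the \<open>\<eta> i\<close>; all others get the
    dummy value 0.\<close>
  define T where "T \<omega> = (\<lambda>j. if j \<in> {1..n} then \<xi> j \<omega> else if j \<in> {n+1..2*n} then \<eta> (j - n) \<omega> else 0)" for \<omega>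
  have meas: "X \<in> borel_measurable M" if "distributed M lborel X std_normal_density" for X :: "'a \<Rightarrow> real"
    using that by (simp add: distributed_def)
  have T: "T \<in> measurable M ?K"
    unfolding T_def
  proof (rule measurable_PiM_single')
    fix j :: nat
    show "(\<lambda>\<omega>. if j \<in> {1..n} then \<xi> j \<omega> else if j \<in> {n+1..2*n} then \<eta> (j - n) \<omega> else 0) \<in> borel_measurable M"
    proof (cases "j \<in> {1..n}")
      case True
      then show ?thesis using meas \<xi> by auto
    next
      case False
      have "j - n \<in> {1..n}" if "j \<in> {n+1..2*n}" using that by auto
      with False show ?thesis using meas \<eta> by (cases "j \<in> {n+1..2*n}") auto
    qed
  qed auto
  define N where "N = distr M ?K T"
  have N: "prob_space N"
    unfolding N_def by (rule prob_space_distr) (rule T)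
  have coord: "(\<lambda>f. f j) \<in> borel_measurable ?K" for j :: nat
    by (rule measurable_component_singleton) simp
  have dist: "distributed N lborel (\<lambda>f. f j) std_normal_density"
    if "distributed M lborel (\<lambda>\<omega>. T \<omega> j) std_normal_density" for j
    using that coord[of j] T unfolding distributed_def N_def by (simp add: distr_distr comp_def)
  have ems: "expected_min_sum N p k n x (\<lambda>i f. f (h i)) = expected_min_sum M p k n x X"
    if "\<And>i \<omega>. i \<in> {1..n} \<Longrightarrow> T \<omega> (h i) = X i \<omega>" for h X
  proof -
    \<comment> \<open>The rewriting happens on the list inside \<open>jmin\<close>, since
      \<open>T\<close> is known to match \<open>X\<close> only at indices from 1 to
      \<open>n\<close>.\<close>
    have eq: "map (\<lambda>i. \<bar>x i * T \<omega> (h i)\<bar> powr p) [1..<Suc n] = map (\<lambda>i. \<bar>x i * X i \<omega>\<bar> powr p) [1..<Suc n]" for \<omega>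
      using that by (intro map_cong) auto
    have "(\<lambda>f. \<Sum>j=1..k. jmin j n (\<lambda>i. \<bar>x i * f (h i)\<bar> powr p)) \<in> borel_measurable ?K"
      using k coord by (intro borel_measurable_sum borel_measurable_jmin) auto
    then have "expected_min_sum N p k n x (\<lambda>i f. f (h i)) =
        expectation (\<lambda>\<omega>. \<Sum>j=1..k. jmin j n (\<lambda>i. \<bar>x i * T \<omega> (h i)\<bar> powr p))"
      unfolding expected_min_sum_def N_def by (rule integral_distr[OF T])
    also have "\<dots> = expected_min_sum M p k n x X"
      unfolding expected_min_sum_def jmin_def eq ..
    finally show ?thesis .
  qed
  have T1: "T \<omega> i = \<xi> i \<omega>" and T2: "T \<omega> (n + i) = \<eta> i \<omega>" if "i \<in> {1..n}" for i \<omega>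
    using that by (auto simp: T_def)
  have "prob_space.indep_vars N (\<lambda>_. borel) (\<lambda>i f. f i) {1..n}"
    unfolding N_def
  proof (rule indep_vars_distr[OF _ T])
    show "indep_vars (\<lambda>_. borel) (\<lambda>i \<omega>. T \<omega> i) {1..n}"
      using indep T1 by (subst indep_vars_cong[of _ "{1..n}" _ \<xi>]) (auto simp: fun_eq_iff)
  qed (use k coord in auto)
  moreover have "\<forall>i\<in>{1..n}. distributed N lborel (\<lambda>f. f i) std_normal_density"
    "\<forall>i\<in>{1..n}. distributed N lborel (\<lambda>f. f (n + i)) std_normal_density"
    using \<xi> \<eta> T1 T2 by (auto intro!: dist)
  ultimately have "expected_min_sum N p k n x (\<lambda>i f. f i) \<le>
      6 * (C * p) powr p * expected_min_sum N p k n x (\<lambda>i f. f (n + i))"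
    using all[OF N, unfolded gaussian_comparison_def, rule_format,
        of p k n x "\<lambda>i f. f i" "\<lambda>i f. f (n + i)"] p k x by blast
  then show "expected_min_sum M p k n x \<xi> \<le> 6 * (C * p) powr p * expected_min_sum M p k n x \<eta>"
    using ems[of "\<lambda>i. i" \<xi>] ems[of "\<lambda>i. n + i" \<eta>] T1 T2 by simp
qed

text \<open>The constant of \<open>expected_min_sum_le\<close> is enlarged:
  \<open>4 \<le> 6\<close>, and \<open>8 \<le> 32 * A / \<delta>\<close> because
  \<open>\<delta> < 1 < A\<close>.\<close>

lemma (in prob_space) cdf_decay_comparison:
  assumes "0 < p" "0 < \<alpha>" "0 < \<beta>" "0 < \<delta>" "\<delta> < 1" "1 < A" "1 \<le> k" "k \<le> n" "0 < x 1" "mono_on {1..n} x"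
    and "\<forall>i\<in>{1..n}. \<xi> i \<in> borel_measurable M \<and>
       alpha_beta_condition M \<alpha> \<beta> (\<xi> i) \<and> cdf_decay_condition M \<delta> A (\<xi> i)"
    and "\<forall>i\<in>{1..n}. \<eta> i \<in> borel_measurable M \<and>
       alpha_beta_condition M \<alpha> \<beta> (\<eta> i) \<and> cdf_decay_condition M \<delta> A (\<eta> i)"
    and indep: "indep_vars (\<lambda>_. borel) \<xi> {1..n}"
  shows "expected_min_sum M p k n x \<xi> \<le>
    6 * (32 * A * \<alpha> / (\<delta> * \<beta>)) powr p * Gamma (1 + p) * expected_min_sum M p k n x \<eta>"
proof -
  note main = expected_min_sum_le[where \<xi> = \<xi> and \<eta> = \<eta>, OF assms(1-3,7-10) _ _ _ _ indep]
  have nn: "0 \<le> expected_min_sum M p k n x \<eta>"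
    by (rule main(1)) (use assms(11,12) in blast)+
  have "8 * \<delta> \<le> 32 * A"
    using assms(4-6) by linarith
  then have "8 * \<delta> * (\<alpha> / (\<delta> * \<beta>)) \<le> 32 * A * (\<alpha> / (\<delta> * \<beta>))"
    using assms(2-4) by (intro mult_right_mono) auto
  then have le: "8 * \<alpha> / \<beta> \<le> 32 * A * \<alpha> / (\<delta> * \<beta>)"
    using assms(4) by simp
  have "expected_min_sum M p k n x \<xi> \<le>
      4 * (8 * \<alpha> / \<beta>) powr p * Gamma (1 + p) * expected_min_sum M p k n x \<eta>"
    by (rule main(2)) (use assms(11,12) in blast)+
  also have "\<dots> \<le> 6 * (32 * A * \<alpha> / (\<delta> * \<beta>)) powr p * Gamma (1 + p) * expected_min_sum M p k n x \<eta>"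
    using nn le assms(1-3) by (intro mult_right_mono mult_mono powr_mono2) (auto intro!: Gamma_real_nonneg)
  finally show ?thesis .
qed

theorem theorem5p4:
  shows "(\<forall>(M :: 'a measure) (p::real) (\<alpha>::real) (\<beta>::real) (\<delta>::real) (A::real) (k::nat) (n::nat)
             (x :: nat \<Rightarrow> real) (\<xi> :: nat \<Rightarrow> 'a \<Rightarrow> real) (\<eta> :: nat \<Rightarrow> 'a \<Rightarrow> real).
           prob_space M \<and>
           0 < p \<and> 0 < \<alpha> \<and> 0 < \<beta> \<and> 0 < \<delta> \<and> \<delta> < 1 \<and> 1 < A \<and>
           1 \<le> k \<and> k \<le> n \<and> 0 < x 1 \<and> mono_on {1..n} x \<and>
           (\<forall>i\<in>{1..n}. \<xi> i \<in> borel_measurable M \<and>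
              alpha_beta_condition M \<alpha> \<beta> (\<xi> i) \<and> cdf_decay_condition M \<delta> A (\<xi> i)) \<and>
           (\<forall>i\<in>{1..n}. \<eta> i \<in> borel_measurable M \<and>
              alpha_beta_condition M \<alpha> \<beta> (\<eta> i) \<and> cdf_decay_condition M \<delta> A (\<eta> i)) \<and>
           prob_space.indep_vars M (\<lambda>_. borel) \<xi> {1..n}
           \<longrightarrow> expected_min_sum M p k n x \<xi>
                 \<le> 6 * (32 * A * \<alpha> / (\<delta> * \<beta>)) powr p * Gamma (1 + p) * expected_min_sum M p k n x \<eta>) \<and>
         (\<exists>C>0. \<forall>M :: 'a measure. prob_space M \<longrightarrow> gaussian_comparison M C) \<and>
         (\<forall>C>0. (\<forall>N :: (nat \<Rightarrow> real) measure. prob_space N \<longrightarrow> gaussian_comparison N C)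
                 \<longrightarrow> (\<forall>M :: 'a measure. prob_space M \<longrightarrow> gaussian_comparison M C))"
proof (intro conjI allI impI)
  show "\<exists>C>0. \<forall>M :: 'a measure. prob_space M \<longrightarrow> gaussian_comparison M C"
    using gaussian_comparison_24 by (intro exI[of _ 24]) auto
qed (elim conjE, rule prob_space.cdf_decay_comparison; assumption | blast intro: gaussian_comparison_transfer)+

end
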